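(* Let $(\mathcal{S},\mathcal{A},\mathcal{P},r)$ be a weakly communicating average reward MDP with optimal gain $g^*\in\mathbb{R}$. Let $Q\in\mathbb{R}^{\mathcal{S}\times\mathcal{A}}$ and let $\pi:\mathcal{S}\to\mathcal{A}$ be a greedy policy for $Q$, i.e. $\pi(s)\in\operatorname{argmax}_{a\in\mathcal{A}}Q(s,a)$ for every $s\in\mathcal{S}$. Then for all states $s\in\mathcal{S}$, $$0\le g^*-g_\pi(s)\le \|Q-\mathcal{T}(Q)\|_{\mathrm{sp}}.$$
   Context: An average reward MDP $(\mathcal{S},\mathcal{A},\mathcal{P},r)$ has finite nonempty state space $\mathcal{S}$, finite nonempty action space $\mathcal{A}$, transition kernel $\mathcal{P}$ (for each $(s,a)$, $\mathcal{P}(\cdot|s,a)$ is a probability distribution on $\mathcal{S}$) and reward $r:\mathcal{S}\times\mathcal{A}\to\mathbb{R}$. A (stationary deterministic) policy is a map $\pi:\mathcal{S}\to\mathcal{A}$; it induces a Markov chain with transition matrix $P_\pi(s'|s)=\mathcal{P}(s'|s,\pi(s))$. Its gain is $g_\pi(s)=\lim_{n\to\infty}\mathbb{E}_\pi\big[\frac1n\sum_{t=0}^{n-1}r(s_t,a_t)\,|\,s_0=s\big]$ with $a_t=\pi(s_t)$, $s_{t+1}\sim\mathcal{P}(\cdot|s_t,a_t)$. The optimal gain is $g^*(s)=\max_\pi g_\pi(s)$. The MDP is weakly communicating if there is a set of states such that each state of the set is accessible from every other state of the set under some policy, and all remaining states (possibly none) are transient under every policy. Under this assumption $g^*(s)$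 does not depend on $s$ and is written as a scalar $g^*\in\mathbb{R}$. For $x\in\mathbb{R}^J$ with $J$ finite, $\|x\|_{\mathrm{sp}}=\max_{j}x(j)-\min_j x(j)$ (span seminorm). The map $\mathcal{T}:\mathbb{R}^{\mathcal{S}\times\mathcal{A}}\to\mathbb{R}^{\mathcal{S}\times\mathcal{A}}$ is $\mathcal{T}(Q)(s,a)=r(s,a)+\sum_{s'\in\mathcal{S}}\mathcal{P}(s'|s,a)\max_{a'\in\mathcal{A}}Q(s',a')$. *)

theory Defs
  imports "HOL-Probability.Probability"
begin

text \<open>
  The state space \<open>'s\<close> and the action space \<open>'a\<close> are types of class finite (hence finite and
  nonempty). The kernel is \<open>P :: 's \<times> 'a \<Rightarrow> 's pmf\<close>, with \<open>pmf (P (s, a)) s'\<close> the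
  probability of moving from \<open>s\<close> to \<open>s'\<close> under \<open>a\<close>. A policy is any function \<open>'s \<Rightarrow> 'a\<close>.
\<close>

text \<open>
  Law of the list \<open>[s\<^sub>0, \<dots>, s\<^sub>n]\<close> of the first \<open>n + 1\<close> states visited under \<open>\<pi>\<close>, with \<open>s\<^sub>0 = s\<close>.
\<close>

primrec trajectory :: "('s \<times> 'a \<Rightarrow> 's pmf) \<Rightarrow> ('s \<Rightarrow> 'a) \<Rightarrow> nat \<Rightarrow> 's \<Rightarrow> 's list pmf" where
  "trajectory P \<pi> 0 s = return_pmf [s]"
| "trajectory P \<pi> (Suc n) s =
     bind_pmf (P (s, \<pi> s)) (\<lambda>s'. map_pmf (\<lambda>xs. s # xs) (trajectory P \<pi> n s'))"

definition gain ::
  "('s::finite \<times> 'a::finite \<Rightarrow> 's pmf) \<Rightarrow> ('s \<times> 'a \<Rightarrow> real) \<Rightarrow> ('s \<Rightarrow> 'a) \<Rightarrow> 's \<Rightarrow> real" where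
  "gain P r \<pi> s = lim (\<lambda>n. measure_pmf.expectation (trajectory P \<pi> n s)
     (\<lambda>xs. 1 / real n * (\<Sum>t<n. r (xs ! t, \<pi> (xs ! t)))))"

definition optimal_gain_at ::
  "('s::finite \<times> 'a::finite \<Rightarrow> 's pmf) \<Rightarrow> ('s \<times> 'a \<Rightarrow> real) \<Rightarrow> 's \<Rightarrow> real" where
  "optimal_gain_at P r s = (MAX \<pi>. gain P r \<pi> s)"

text \<open>
  The scalar optimal gain; meaningful when \<open>optimal_gain_at P r\<close> is constant, which is the case
  for weakly communicating MDPs.
\<close>

definition optimal_gain ::
  "('s::finite \<times> 'a::finite \<Rightarrow> 's pmf) \<Rightarrow> ('s \<times> 'a \<Rightarrow> real) \<Rightarrow> real" where
  "optimal_gain P r = (THE g. \<forall>s. optimal_gain_at P r s = g)"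

definition accessible_under ::
  "('s \<times> 'a \<Rightarrow> 's pmf) \<Rightarrow> ('s \<Rightarrow> 'a) \<Rightarrow> 's \<Rightarrow> 's \<Rightarrow> bool" where
  "accessible_under P \<pi> s s' \<longleftrightarrow>
     (\<exists>n. measure_pmf.prob (trajectory P \<pi> n s) {xs. xs ! n = s'} > 0)"

text \<open>
  The events \<open>\<exists>t\<in>{1..n}. s\<^sub>t = s\<close> increase with \<open>n\<close> to the event of returning to \<open>s\<close>, so by
  continuity of measure the supremum is the probability of ever returning.
\<close>

definition return_prob :: "('s \<times> 'a \<Rightarrow> 's pmf) \<Rightarrow> ('s \<Rightarrow> 'a) \<Rightarrow> 's \<Rightarrow> real" where
  "return_prob P \<pi> s =
     (SUP n. measure_pmf.prob (trajectory P \<pi> n s) {xs. \<exists>t\<in>{1..n}. xs ! t = s})"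

definition transient_under :: "('s \<times> 'a \<Rightarrow> 's pmf) \<Rightarrow> ('s \<Rightarrow> 'a) \<Rightarrow> 's \<Rightarrow> bool" where
  "transient_under P \<pi> s \<longleftrightarrow> return_prob P \<pi> s < 1"

definition weakly_communicating :: "('s::finite \<times> 'a::finite \<Rightarrow> 's pmf) \<Rightarrow> bool" where
  "weakly_communicating P \<longleftrightarrow>
     (\<exists>C. (\<forall>s\<in>C. \<forall>s'\<in>C. s \<noteq> s' \<longrightarrow> (\<exists>\<pi>. accessible_under P \<pi> s s')) \<and>
          (\<forall>s. s \<notin> C \<longrightarrow> (\<forall>\<pi>. transient_under P \<pi> s)))"

definition span_seminorm :: "('j::finite \<Rightarrow> real) \<Rightarrow> real" where
  "span_seminorm x = (MAX j. x j) - (MIN j. x j)"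

definition bellman ::
  "('s::finite \<times> 'a::finite \<Rightarrow> 's pmf) \<Rightarrow> ('s \<times> 'a \<Rightarrow> real) \<Rightarrow> ('s \<times> 'a \<Rightarrow> real) \<Rightarrow> 's \<times> 'a \<Rightarrow> real"
  where
  "bellman P r Q = (\<lambda>(s, a). r (s, a) + (\<Sum>s'\<in>UNIV. pmf (P (s, a)) s' * (MAX a'. Q (s', a'))))"

definition greedy_policy :: "('s \<times> 'a \<Rightarrow> real) \<Rightarrow> ('s \<Rightarrow> 'a) \<Rightarrow> bool" where
  "greedy_policy Q \<pi> \<longleftrightarrow> (\<forall>s. is_arg_max (\<lambda>a. Q (s, a)) (\<lambda>_. True) (\<pi> s))"

end

theory Submission
  imports Defs
begin

text \<open>
  Writing \<open>D = Q - T(Q)\<close> and \<open>v(s) = max\<^sub>a Q(s, a)\<close>, the reward is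
  \<open>r(s, a) = Q(s, a) - D(s, a) - \<Sum>s'. P(s'|s, a) v(s')\<close>. Since \<open>Q \<le> v\<close>, with equality along the greedy
  policy, summing along a trajectory telescopes \<open>v\<close>: every policy has gain at most \<open>- min D\<close>, and
  the greedy one has gain at least \<open>- max D\<close>.

  The optimal gain is constant because the maximum \<open>G\<close> of all gains, attained say by \<open>\<pi>\<close>, is attained
  on a set closed under \<open>\<pi>\<close>, as gains are harmonic. This set contains a recurrent state and is
  therefore reachable from everywhere; following \<open>\<pi>\<close> inside it and moving towards it outside yields
  gain \<open>G\<close> from every state.
\<close>

section \<open>The averaging operator of a finite Markov chain\<close>

definition push :: "('s::finite \<Rightarrow> 's pmf) \<Rightarrow> ('s \<Rightarrow> real) \<Rightarrow> 's \<Rightarrow> real" where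
  "push K f s = (\<Sum>y\<in>UNIV. pmf (K s) y * f y)"

lemma push_add: "push K (\<lambda>x. f x + g x) s = push K f s + push K g s"
  by (simp add: push_def algebra_simps sum.distrib)

lemma push_diff: "push K (\<lambda>x. f x - g x) s = push K f s - push K g s"
  by (simp add: push_def algebra_simps sum_subtractf)

lemma push_cmult: "push K (\<lambda>x. c * f x) s = c * push K f s"
  by (simp add: push_def sum_distrib_left mult.left_commute)

lemma push_uminus: "push K (\<lambda>x. - f x) s = - push K f s"
  by (simp add: push_def sum_negf)

lemma push_const [simp]: "push K (\<lambda>x. c) s = c"
proof -
  have "(\<Sum>y\<in>UNIV. pmf (K s) y) = 1"
    by (rule sum_pmf_eq_1) auto
  thus ?thesis
    by (simp add: push_def flip: sum_distrib_right)
qed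

lemma push_mono: "(\<And>x. f x \<le> g x) \<Longrightarrow> push K f s \<le> push K g s"
  by (auto simp: push_def intro!: sum_mono mult_left_mono)

lemma push_cong_support:
  assumes "\<And>y. y \<in> set_pmf (K s) \<Longrightarrow> f y = g y"
  shows "push K f s = push K g s"
  unfolding push_def using assms by (intro sum.cong) (auto simp: set_pmf_iff)

text \<open>Minimum principle: an average of the terms \<open>f z - m\<close>, nonnegative on the
  support, vanishes only if each of them vanishes there.\<close>

lemma push_eq_minD:
  assumes "\<And>y. y \<in> set_pmf (K s) \<Longrightarrow> m \<le> f y" and "push K f s = m"
    and "y \<in> set_pmf (K s)"
  shows "f y = m"
proof -
  have "(\<Sum>z\<in>UNIV. pmf (K s) z * (f z - m)) = 0"
    using assms(2) push_diff[of K f "\<lambda>_. m" s] by (simp add: push_def[of K "\<lambda>x. f x - m"])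
  moreover have "0 \<le> pmf (K s) z * (f z - m)" for z
    using assms(1)[of z] by (cases "z \<in> set_pmf (K s)") (auto simp: set_pmf_iff)
  ultimately have "pmf (K s) y * (f y - m) = 0"
    by (simp add: sum_nonneg_eq_0_iff)
  thus ?thesis
    using assms(3) by (simp add: set_pmf_iff)
qed

lemma push_iterate_bound:
  assumes "\<And>x. \<bar>f x\<bar> \<le> b"
  shows "\<bar>(push K ^^ n) f s\<bar> \<le> b"
proof (induction n arbitrary: s)
  case (Suc n)
  have "(push K ^^ n) f x \<le> b" "- b \<le> (push K ^^ n) f x" for x
    using Suc[of x] by linarith+
  hence "push K ((push K ^^ n) f) s \<le> push K (\<lambda>_. b) s"
    "push K (\<lambda>_. - b) s \<le> push K ((push K ^^ n) f) s"
    by (intro push_mono; simp)+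
  thus ?case
    by (simp add: abs_le_iff)
qed (use assms in auto)

lemma push_iterate_over_n_tendsto_0:
  "(\<lambda>n. (push K ^^ n) f s / real n) \<longlonglongrightarrow> 0"
proof (rule Lim_null_comparison)
  have b: "\<bar>f x\<bar> \<le> (MAX x. \<bar>f x\<bar>)" for x
    by (rule Max_ge) auto
  show "\<forall>\<^sub>F n in sequentially. norm ((push K ^^ n) f s / real n) \<le> (MAX x. \<bar>f x\<bar>) / real n"
    using push_iterate_bound[where s = s and K = K, OF b]
    by (intro always_eventually) (auto intro: divide_right_mono)
  show "(\<lambda>n. (MAX x. \<bar>f x\<bar>) / real n) \<longlonglongrightarrow> 0"
    by (rule lim_const_over_n)
qed

section \<open>Cumulative rewards and the Poisson equation\<close>

primrec total_reward :: "('s::finite \<Rightarrow> 's pmf) \<Rightarrow> ('s \<Rightarrow> real) \<Rightarrow> nat \<Rightarrow> 's \<Rightarrow> real" where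
  "total_reward K f 0 s = 0"
| "total_reward K f (Suc n) s = f s + push K (total_reward K f n) s"

lemma total_reward_mono: "(\<And>x. f x \<le> g x) \<Longrightarrow> total_reward K f n s \<le> total_reward K g n s"
  by (induction n arbitrary: s) (auto intro!: add_mono push_mono)

text \<open>Harmonic \<open>g\<close> contributes \<open>g s\<close> at every step, and the
  increments \<open>h - push K h\<close> cancel except for the two ends.\<close>

lemma total_reward_telescope:
  assumes "\<And>s. push K g s = g s" and "\<And>s. f s = g s + h s - push K h s"
  shows "total_reward K f n s = real n * g s + h s - (push K ^^ n) h s"
proof (induction n arbitrary: s)
  case (Suc n)
  have "total_reward K f n = (\<lambda>s. real n * g s + h s - (push K ^^ n) h s)"
    using Suc by auto
  thus ?case
    using assms(2)[of s] by (simp add: push_add push_diff push_cmult assms(1) algebra_simps)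
qed auto

lemma total_reward_over_n_tendsto:
  assumes "\<And>s. push K g s = g s" and "\<And>s. f s = g s + h s - push K h s"
  shows "(\<lambda>n. total_reward K f n s / real n) \<longlonglongrightarrow> g s"
proof -
  have "(\<lambda>n. g s + h s / real n - (push K ^^ n) h s / real n) \<longlonglongrightarrow> g s + 0 - 0"
    by (intro tendsto_intros lim_const_over_n push_iterate_over_n_tendsto_0)
  moreover have "\<forall>\<^sub>F n in sequentially. g s + h s / real n - (push K ^^ n) h s / real n
      = total_reward K f n s / real n"
    using eventually_gt_at_top[of 0]
    by eventually_elim (simp add: total_reward_telescope[OF assms] field_simps)
  ultimately show ?thesis
    by (simp add: tendsto_cong)
qed

text \<open>
  Bounded iterates force \<open>I - K\<close> to be injective, hence bijective, on its own range; so
  \<open>(I - K) f = (I - K) ((I - K) h)\<close> for some \<open>h\<close>, and \<open>g = f - (I - K) h\<close> is harmonic.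
\<close>

lemma poisson_equation:
  fixes K :: "'s::finite \<Rightarrow> 's pmf"
  obtains g h where "\<And>s. push K g s = g s" "\<And>s. f s = g s + h s - push K h s"
proof -
  define T :: "real ^ 's \<Rightarrow> real ^ 's" where "T v = (\<chi> s. v $ s - push K (($) v) s)" for v
  have linT: "linear T"
  proof (rule linearI)
    show "T (u + v) = T u + T v" for u v
      by (simp add: T_def vec_eq_iff push_def algebra_simps sum.distrib)
    show "T (c *\<^sub>R v) = c *\<^sub>R T v" for c v
      by (simp add: T_def vec_eq_iff push_def algebra_simps sum_distrib_left)
  qed
  have inj: "inj_on T (range T)"
  proof (subst linear_inj_on_iff_eq_0[OF linT])
    show "subspace (range T)"
      by (simp add: linear_subspace_image linT)
    show "\<forall>x\<in>range T. T x = 0 \<longrightarrow> x = 0"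
    proof (intro ballI impI)
      fix x assume "x \<in> range T" "T x = 0"
      then obtain y where y: "x = T y" by blast
      have harm: "push K (($) x) s = x $ s" for s
        using \<open>T x = 0\<close> by (simp add: T_def vec_eq_iff)
      have x_eq: "x $ s = y $ s - push K (($) y) s" for s
        by (simp add: y T_def)
      have "x $ s = 0" for s
      proof -
        \<comment> \<open>The pair \<open>x\<close>, \<open>-y\<close> solves the Poisson equation
          for reward 0, so the averages of the zero reward converge to \<open>x $ s\<close>.\<close>
        have "(\<lambda>n. total_reward K (\<lambda>_. 0) n s / real n) \<longlonglongrightarrow> x $ s"
          by (rule total_reward_over_n_tendsto[of K "($) x" _ "\<lambda>s. - (y $ s)"])
            (simp_all add: harm x_eq push_uminus)
        moreover have "total_reward K (\<lambda>_. 0) n = (\<lambda>_. 0)" for n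
          by (induction n) auto
        ultimately show ?thesis
          by (simp add: LIMSEQ_const_iff)
      qed
      thus "x = 0"
        by (simp add: vec_eq_iff)
    qed
  qed
  have "T ` range T = range T"
  proof (rule subspace_dim_equal)
    show "subspace (T ` range T)" "subspace (range T)"
      by (simp_all add: linear_subspace_image linT)
    show "T ` range T \<subseteq> range T" by blast
    have "span (range T) = range T"
      by (simp add: linear_subspace_image linT)
    thus "dim (range T) \<le> dim (T ` range T)"
      using dim_image_eq[OF linT, of "range T"] inj by (metis order_refl)
  qed
  then obtain y where y: "T (\<chi> s. f s) = T (T y)"
    by (metis (no_types, lifting) imageE rangeI)
  define g where "g s = f s - T y $ s" for s
  have "push K g s = g s" for s
  proof -
    have "T (\<chi> s. f s) $ s = T (T y) $ s"
      using y by simp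
    moreover have "($) (vec_lambda f) = f"
      by (rule ext) simp
    ultimately have "f s - push K f s = T y $ s - push K (($) (T y)) s"
      by (simp add: T_def[of "\<chi> s. f s"] T_def[of "T y"])
    thus ?thesis
      by (simp add: g_def[abs_def] push_diff)
  qed
  moreover have "f s = g s + y $ s - push K (($) y) s" for s
    by (simp add: g_def T_def)
  ultimately show thesis
    using that by blast
qed

section \<open>Trajectory laws and the existence of gains\<close>

lemma finite_set_pmf_trajectory [simp]:
  fixes P :: "'s::finite \<times> 'a \<Rightarrow> 's pmf"
  shows "finite (set_pmf (trajectory P \<pi> n s))"
  by (induction n arbitrary: s) auto

lemma expectation_trajectory_Suc:
  fixes P :: "'s::finite \<times> 'a \<Rightarrow> 's pmf" and F :: "'s list \<Rightarrow> real"
  shows "measure_pmf.expectation (trajectory P \<pi> (Suc n) s) F =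
    push (\<lambda>s. P (s, \<pi> s))
      (\<lambda>s'. measure_pmf.expectation (trajectory P \<pi> n s') (\<lambda>xs. F (s # xs))) s"
  unfolding trajectory.simps push_def
  by (subst pmf_expectation_bind[where A = UNIV]) auto

lemma prob_trajectory_Suc:
  fixes P :: "'s::finite \<times> 'a \<Rightarrow> 's pmf"
  shows "measure_pmf.prob (trajectory P \<pi> (Suc n) s) A =
    push (\<lambda>s. P (s, \<pi> s)) (\<lambda>s'. measure_pmf.prob (trajectory P \<pi> n s') {xs. s # xs \<in> A}) s"
proof -
  have "(\<lambda>xs. indicator A (s # xs) :: real) = indicator {xs. s # xs \<in> A}"
    by (auto simp: indicator_def)
  thus ?thesis
    using expectation_trajectory_Suc[of P \<pi> n s "indicator A"] by simp
qed

lemma expectation_trajectory_sum: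
  fixes P :: "'s::finite \<times> 'a \<Rightarrow> 's pmf" and f :: "'s \<Rightarrow> real"
  shows "measure_pmf.expectation (trajectory P \<pi> n s) (\<lambda>xs. \<Sum>t<n. f (xs ! t)) =
    total_reward (\<lambda>s. P (s, \<pi> s)) f n s"
proof (induction n arbitrary: s)
  case (Suc n)
  have "measure_pmf.expectation (trajectory P \<pi> n s') (\<lambda>xs. \<Sum>t<Suc n. f ((s # xs) ! t)) =
    f s + total_reward (\<lambda>s. P (s, \<pi> s)) f n s'" for s'
    unfolding sum.lessThan_Suc_shift
    by (simp add: Suc integrable_measure_pmf_finite del: sum.lessThan_Suc)
  thus ?case
    unfolding expectation_trajectory_Suc by (simp add: push_add)
qed auto

lemma gain_eqI:
  fixes P :: "'s::finite \<times> 'a::finite \<Rightarrow> 's pmf"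
  assumes "\<And>s. push (\<lambda>s. P (s, \<pi> s)) g s = g s"
    and "\<And>s. r (s, \<pi> s) = g s + h s - push (\<lambda>s. P (s, \<pi> s)) h s"
  shows "gain P r \<pi> s = g s"
proof -
  have "(\<lambda>n. total_reward (\<lambda>s. P (s, \<pi> s)) (\<lambda>s. r (s, \<pi> s)) n s / real n) \<longlonglongrightarrow> g s"
    by (rule total_reward_over_n_tendsto[OF assms])
  thus ?thesis
    unfolding gain_def
    by (simp add: limI expectation_trajectory_sum[of P \<pi> _ _ "\<lambda>s. r (s, \<pi> s)"])
qed

text \<open>The limit behind \<open>lim\<close> in \<open>gain\<close> exists because the Poisson
  equation is solvable; the gain is then the harmonic part of the solution.\<close>

lemma
  fixes P :: "'s::finite \<times> 'a::finite \<Rightarrow> 's pmf"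
  shows gain_tendsto:
      "(\<lambda>n. total_reward (\<lambda>s. P (s, \<pi> s)) (\<lambda>s. r (s, \<pi> s)) n s / real n) \<longlonglongrightarrow> gain P r \<pi> s"
    and push_gain: "push (\<lambda>s. P (s, \<pi> s)) (gain P r \<pi>) s = gain P r \<pi> s"
proof -
  obtain g h where gh: "\<And>s. push (\<lambda>s. P (s, \<pi> s)) g s = g s"
    "\<And>s. r (s, \<pi> s) = g s + h s - push (\<lambda>s. P (s, \<pi> s)) h s"
    by (rule poisson_equation[of "\<lambda>s. P (s, \<pi> s)" "\<lambda>s. r (s, \<pi> s)"]) blast
  have g: "gain P r \<pi> = g"
    using gain_eqI[of P \<pi> g r h, OF gh] by blast
  show "(\<lambda>n. total_reward (\<lambda>s. P (s, \<pi> s)) (\<lambda>s. r (s, \<pi> s)) n s / real n) \<longlonglongrightarrow> gain P r \<pi> s"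
    unfolding g by (rule total_reward_over_n_tendsto[OF gh])
  show "push (\<lambda>s. P (s, \<pi> s)) (gain P r \<pi>) s = gain P r \<pi> s"
    unfolding g by (rule gh)
qed

section \<open>Gain bounds from the Bellman residual\<close>

lemma gain_mono:
  fixes P :: "'s::finite \<times> 'a::finite \<Rightarrow> 's pmf"
  assumes "\<And>s. r (s, \<pi> s) \<le> r' (s, \<pi> s)"
  shows "gain P r \<pi> s \<le> gain P r' \<pi> s"
  by (rule LIMSEQ_le[OF gain_tendsto gain_tendsto])
    (auto intro!: exI[of _ 0] divide_right_mono total_reward_mono assms)

text \<open>For every policy the constant \<open>c\<close> together with \<open>v\<close> solves the
  Poisson equation. Such rewards serve as comparison rewards of known gain.\<close>

lemma gain_coboundary:
  fixes P :: "'s::finite \<times> 'a::finite \<Rightarrow> 's pmf"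
  shows "gain P (\<lambda>(s, a). c + v s - (\<Sum>s'\<in>UNIV. pmf (P (s, a)) s' * v s')) \<pi> s = c"
  by (rule gain_eqI[where g = "\<lambda>_. c" and h = v]) (simp_all add: push_def[of _ v])

lemma gain_bellman_residual_bounds:
  fixes P :: "'s::finite \<times> 'a::finite \<Rightarrow> 's pmf"
  defines "D \<equiv> \<lambda>Q r z. Q z - bellman P r Q z"
  shows "gain P r \<pi>' s \<le> - (MIN z. D Q r z)"
    and "greedy_policy Q \<pi> \<Longrightarrow> - (MAX z. D Q r z) \<le> gain P r \<pi> s"
proof -
  define v where "v s = (MAX a. Q (s, a))" for s
  let ?c = "\<lambda>c. \<lambda>(s, a). c + v s - (\<Sum>s'\<in>UNIV. pmf (P (s, a)) s' * v s')"
  have r: "r (s, a) = Q (s, a) - D Q r (s, a) - (\<Sum>s'\<in>UNIV. pmf (P (s, a)) s' * v s')" for s a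
    by (simp add: D_def bellman_def v_def)
  have Q_le: "Q (s, a) \<le> v s" for s a
    unfolding v_def by (rule Max_ge) auto
  have D_ge: "(MIN z. D Q r z) \<le> D Q r z" for z
    by (rule Min_le) auto
  \<comment> \<open>The comparison reward has the same sum over \<open>v\<close> as
    \<open>r\<close>; \<open>Q\<close> is raised to \<open>v\<close> and \<open>D\<close> lowered to
    its minimum.\<close>
  have "r (s, a) \<le> ?c (- (MIN z. D Q r z)) (s, a)" for s a
    using Q_le[of s a] D_ge[of "(s, a)"] unfolding r[of s a] prod.case by linarith
  hence "gain P r \<pi>' s \<le> gain P (?c (- (MIN z. D Q r z))) \<pi>' s"
    by (intro gain_mono)
  thus "gain P r \<pi>' s \<le> - (MIN z. D Q r z)"
    by (simp only: gain_coboundary)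
  assume greedy: "greedy_policy Q \<pi>"
  have Q_eq: "Q (s, \<pi> s) = v s" for s
    unfolding v_def using greedy
    by (intro Max_eqI[symmetric])
      (force simp: greedy_policy_def is_arg_max_def not_less intro: leI)+
  have D_le: "D Q r z \<le> (MAX z. D Q r z)" for z
    by (rule Max_ge) auto
  have "?c (- (MAX z. D Q r z)) (s, \<pi> s) \<le> r (s, \<pi> s)" for s
    using Q_eq[of s] D_le[of "(s, \<pi> s)"] unfolding r[of s "\<pi> s"] prod.case by linarith
  hence "gain P (?c (- (MAX z. D Q r z))) \<pi> s \<le> gain P r \<pi> s"
    by (intro gain_mono)
  thus "- (MAX z. D Q r z) \<le> gain P r \<pi> s"
    by (simp only: gain_coboundary)
qed

section \<open>Closed sets, hitting probabilities and recurrent states\<close>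

definition closed_under :: "('s \<Rightarrow> 's pmf) \<Rightarrow> 's set \<Rightarrow> bool" where
  "closed_under K U \<longleftrightarrow> (\<forall>x\<in>U. set_pmf (K x) \<subseteq> U)"

text \<open>Maximum principle, obtained from \<open>push_eq_minD\<close> for \<open>- f\<close>: an
  average equal to the maximum forces the maximum at every successor.\<close>

lemma closed_under_max_harmonic:
  fixes f :: "'s::finite \<Rightarrow> real"
  assumes "\<And>s. push K f s = f s"
  shows "closed_under K {s. f s = (MAX x. f x)}"
  unfolding closed_under_def
proof safe
  fix x y assume x: "f x = (MAX x. f x)" and y: "y \<in> set_pmf (K x)"
  have "- f y = - (MAX x. f x)"
  proof (rule push_eq_minD[where f = "\<lambda>y. - f y" and s = x])
    show "y \<in> set_pmf (K x)" by (rule y)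
    show "- (MAX x. f x) \<le> - f z" for z
      by simp
    show "push K (\<lambda>y. - f y) x = - (MAX x. f x)"
      using assms x by (simp add: push_uminus)
  qed
  thus "f y = (MAX x. f x)" by linarith
qed

lemma trajectory_nth_0: "xs \<in> set_pmf (trajectory P \<pi> n s) \<Longrightarrow> xs ! 0 = s"
  by (cases n) auto

text \<open>The terms of \<open>return_prob\<close> with the starting state \<open>x\<close> freed
  from the target \<open>s\<close>, so that a one-step recursion is available.\<close>

definition hit_prob ::
    "('s \<times> 'a \<Rightarrow> 's pmf) \<Rightarrow> ('s \<Rightarrow> 'a) \<Rightarrow> 's \<Rightarrow> nat \<Rightarrow> 's \<Rightarrow> real" where
  "hit_prob P \<pi> s n x = measure_pmf.prob (trajectory P \<pi> n x) {xs. \<exists>t\<in>{1..n}. xs ! t = s}"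

text \<open>First-step analysis: time 0 of the rest of the path is time 1 of the whole path, so
  arriving at \<open>s\<close> in the first move already is a hit.\<close>

lemma hit_prob_Suc:
  fixes P :: "'s::finite \<times> 'a \<Rightarrow> 's pmf"
  shows "hit_prob P \<pi> s (Suc n) x =
    push (\<lambda>s. P (s, \<pi> s)) (\<lambda>y. if y = s then 1 else hit_prob P \<pi> s n y) x"
proof -
  have shift: "(\<exists>t\<in>{1..Suc n}. (x # xs) ! t = s) \<longleftrightarrow> xs ! 0 = s \<or> (\<exists>t\<in>{1..n}. xs ! t = s)" for xs
  proof -
    have "{0..n} = insert 0 {1..n}"
      by auto
    hence shift_eq: "{1..Suc n} = Suc ` insert 0 {1..n}"
      using image_Suc_atLeastAtMost[of 0 n] by simp
    show ?thesis
      unfolding shift_eq by (simp del: image_insert image_Suc_atLeastAtMost)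
  qed
  have "measure_pmf.prob (trajectory P \<pi> n y) {xs. xs ! 0 = s \<or> (\<exists>t\<in>{1..n}. xs ! t = s)} =
    (if y = s then 1 else hit_prob P \<pi> s n y)" for y
  proof -
    \<comment> \<open>Paths from \<open>y\<close> start with \<open>y\<close> almost surely, so the
      two events differ only by a null set.\<close>
    have "measure_pmf.prob (trajectory P \<pi> n y) {xs. xs ! 0 = s \<or> (\<exists>t\<in>{1..n}. xs ! t = s)} =
      measure_pmf.prob (trajectory P \<pi> n y) (if y = s then UNIV else {xs. \<exists>t\<in>{1..n}. xs ! t = s})"
      by (rule measure_prob_cong_0) (auto simp: pmf_eq_0_set_pmf split: if_splits dest: trajectory_nth_0)
    thus ?thesis by (simp add: hit_prob_def)
  qed
  thus ?thesis
    unfolding hit_prob_def[of P \<pi> s "Suc n"] prob_trajectory_Suc mem_Collect_eq shift by simp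
qed

text \<open>The sequence is bounded and monotone; monotonicity propagates through the first-step
  recursion. Convergence is needed to pass to the limit in that recursion.\<close>

lemma hit_prob_tendsto:
  fixes P :: "'s::finite \<times> 'a \<Rightarrow> 's pmf"
  shows "(\<lambda>n. hit_prob P \<pi> s n x) \<longlonglongrightarrow> (SUP n. hit_prob P \<pi> s n x)"
proof (rule LIMSEQ_incseq_SUP)
  show "bdd_above (range (\<lambda>n. hit_prob P \<pi> s n x))"
    by (rule bdd_aboveI[of _ 1]) (auto simp: hit_prob_def)
  have "hit_prob P \<pi> s n x \<le> hit_prob P \<pi> s (Suc n) x" for n
  proof (induction n arbitrary: x)
    case 0
    show ?case by (simp add: hit_prob_def)
  next
    case (Suc n)
    have "push (\<lambda>s. P (s, \<pi> s)) (\<lambda>y. if y = s then 1 else hit_prob P \<pi> s n y) x \<le>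
      push (\<lambda>s. P (s, \<pi> s)) (\<lambda>y. if y = s then 1 else hit_prob P \<pi> s (Suc n) y) x"
      by (rule push_mono) (use Suc in auto)
    thus ?case
      using hit_prob_Suc[of P \<pi> s n x] hit_prob_Suc[of P \<pi> s "Suc n" x] by linarith
  qed
  thus "incseq (\<lambda>n. hit_prob P \<pi> s n x)"
    by (rule incseq_SucI)
qed

text \<open>
  In a minimal closed set the minimum of the hitting probability of \<open>s\<close> is attained on a closed
  subset; if it were below 1, this subset would miss \<open>s\<close>.
\<close>

lemma closed_under_obtains_recurrent:
  fixes P :: "'s::finite \<times> 'a \<Rightarrow> 's pmf"
  defines "K \<equiv> \<lambda>\<pi> s. P (s, \<pi> s)"
  assumes "closed_under (K \<pi>) U" and "U \<noteq> {}"
  obtains s where "s \<in> U" "\<not> transient_under P \<pi> s"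
proof -
  define A where "A = {R. R \<subseteq> U \<and> R \<noteq> {} \<and> closed_under (K \<pi>) R}"
  have "finite A" "A \<noteq> {}"
    using assms by (auto simp: A_def)
  from finite_has_minimal[OF this] obtain R
    where "R \<in> A" and min: "\<forall>R'\<in>A. R' \<subseteq> R \<longrightarrow> R = R'" by blast
  hence R: "R \<subseteq> U" "R \<noteq> {}" "closed_under (K \<pi>) R"
    by (simp_all add: A_def)
  obtain s where s: "s \<in> R"
    using R by auto
  define h where "h x = (SUP n. hit_prob P \<pi> s n x)" for x
  \<comment> \<open>Counting a start in \<open>s\<close> as a hit makes the limit of the first-step
    recursion read \<open>push (K \<pi>) h' x = h x\<close>.\<close>
  define h' where "h' x = (if x = s then 1 else h x)" for x
  have push_h': "push (K \<pi>) h' x = h x" for x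
  proof (rule LIMSEQ_unique)
    have "(\<lambda>n. if y = s then 1 else hit_prob P \<pi> s n y) \<longlonglongrightarrow> h' y" for y
      using hit_prob_tendsto[of P \<pi> s y] by (auto simp: h'_def h_def)
    thus "(\<lambda>n. hit_prob P \<pi> s (Suc n) x) \<longlonglongrightarrow> push (K \<pi>) h' x"
      unfolding hit_prob_Suc push_def K_def by (intro tendsto_intros)
    show "(\<lambda>n. hit_prob P \<pi> s (Suc n) x) \<longlonglongrightarrow> h x"
      unfolding h_def by (rule LIMSEQ_Suc[OF hit_prob_tendsto])
  qed
  define m where "m = Min (h' ` R)"
  have m_le: "m \<le> h' x" if "x \<in> R" for x
    using that by (simp add: m_def)
  have "m \<ge> 1"
  proof (rule ccontr)
    assume "\<not> m \<ge> 1"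
    let ?R' = "{x \<in> R. h' x = m}"
    have "m \<in> h' ` R"
      unfolding m_def using s by (intro Min_in) auto
    hence "?R' \<noteq> {}" by auto
    moreover have "closed_under (K \<pi>) ?R'"
      unfolding closed_under_def
    proof safe
      fix x y assume x: "x \<in> R" "m = h' x" and y: "y \<in> set_pmf (K \<pi> x)"
      have sub: "set_pmf (K \<pi> x) \<subseteq> R"
        using x R by (auto simp: closed_under_def)
      thus "y \<in> R" using y by blast
      \<comment> \<open>Since \<open>m < 1\<close>, \<open>x\<close> is not \<open>s\<close>, so
        \<open>h' x = h x\<close> and the average of \<open>h'\<close> at \<open>x\<close> is its
        minimum over \<open>R\<close>.\<close>
      have "push (K \<pi>) h' x = m"
        using push_h'[of x] x \<open>\<not> m \<ge> 1\<close> by (auto simp: h'_def split: if_splits)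
      from push_eq_minD[OF _ this y] show "h' y = h' x"
        using m_le sub x by blast
    qed
    ultimately have "R = ?R'"
      using R by (intro min[rule_format]) (auto simp: A_def)
    hence "h' s = m" using s by blast
    thus False using \<open>\<not> m \<ge> 1\<close> by (simp add: h'_def)
  qed
  have "set_pmf (K \<pi> s) \<subseteq> R"
    using s R by (auto simp: closed_under_def)
  \<comment> \<open>On \<open>R\<close> the maximum with 1 changes nothing; it supplies a lower
    bound by 1 at all states, as \<open>push_mono\<close> requires.\<close>
  hence "push (K \<pi>) (\<lambda>x. max 1 (h' x)) s = push (K \<pi>) h' s"
    using m_le \<open>m \<ge> 1\<close> by (intro push_cong_support) (meson max.absorb2 order_trans subsetD)
  moreover have "push (K \<pi>) (\<lambda>_. 1) s \<le> push (K \<pi>) (\<lambda>x. max 1 (h' x)) s"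
    by (rule push_mono) auto
  ultimately have "1 \<le> h s"
    using push_h'[of s] by simp
  hence "\<not> transient_under P \<pi> s"
    by (simp add: transient_under_def return_prob_def h_def hit_prob_def)
  thus thesis
    using that s R by blast
qed

section \<open>Reachability and modified policies\<close>

text \<open>The action may change from step to step, so paths found under different policies can be
  concatenated.\<close>

definition step_rel :: "('s \<times> 'a \<Rightarrow> 's pmf) \<Rightarrow> ('s \<times> 's) set" where
  "step_rel P = {(x, y). \<exists>a. y \<in> set_pmf (P (x, a))}"

lemma trajectory_reachable:
  assumes "xs \<in> set_pmf (trajectory P \<pi> n s)"
  shows "(s, xs ! n) \<in> (step_rel P)\<^sup>*"
  using assms
proof (induction n arbitrary: s xs)
  case (Suc n)
  then obtain s' ys where "s' \<in> set_pmf (P (s, \<pi> s))" "ys \<in> set_pmf (trajectory P \<pi> n s')"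
    and "xs = s # ys" by auto
  moreover from this have "(s, s') \<in> step_rel P"
    by (auto simp: step_rel_def)
  ultimately show ?case
    using Suc.IH by (auto intro: converse_rtrancl_into_rtrancl)
qed auto

lemma accessible_under_imp_reachable:
  assumes "accessible_under P \<pi> s s'"
  shows "(s, s') \<in> (step_rel P)\<^sup>*"
proof -
  obtain n where "measure_pmf.prob (trajectory P \<pi> n s) {xs. xs ! n = s'} \<noteq> 0"
    using assms unfolding accessible_under_def by (metis less_irrefl)
  then obtain xs where "xs \<in> set_pmf (trajectory P \<pi> n s)" "xs ! n = s'"
    by (auto simp: measure_pmf_zero_iff)
  thus ?thesis
    using trajectory_reachable by metis
qed

text \<open>A chain started in \<open>U\<close> never leaves \<open>U\<close>, so it cannot tell
  \<open>K'\<close> from \<open>K\<close> or \<open>f'\<close> from \<open>f\<close>.\<close>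

lemma total_reward_eq_on_closed:
  assumes "closed_under K U" and "\<And>x. x \<in> U \<Longrightarrow> K' x = K x" "\<And>x. x \<in> U \<Longrightarrow> f' x = f x"
    and "x \<in> U"
  shows "total_reward K' f' n x = total_reward K f n x"
  using assms(4)
proof (induction n arbitrary: x)
  case (Suc n)
  have "push K' (total_reward K' f' n) x = push K (total_reward K' f' n) x"
    using assms(2) Suc.prems by (simp add: push_def)
  also have "\<dots> = push K (total_reward K f n) x"
    using assms(1) Suc by (intro push_cong_support) (auto simp: closed_under_def)
  finally show ?case
    using assms(3) Suc.prems by simp
qed auto

lemma gain_eq_on_closed:
  fixes P :: "'s::finite \<times> 'a::finite \<Rightarrow> 's pmf"
  assumes "closed_under (\<lambda>s. P (s, \<pi> s)) U" and "\<And>x. x \<in> U \<Longrightarrow> \<pi>' x = \<pi> x" and "x \<in> U"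
  shows "gain P r \<pi>' x = gain P r \<pi> x"
proof (rule LIMSEQ_unique[OF gain_tendsto])
  have "total_reward (\<lambda>s. P (s, \<pi>' s)) (\<lambda>s. r (s, \<pi>' s)) n x =
    total_reward (\<lambda>s. P (s, \<pi> s)) (\<lambda>s. r (s, \<pi> s)) n x" for n
    by (rule total_reward_eq_on_closed[OF assms(1)]) (simp_all add: assms)
  thus "(\<lambda>n. total_reward (\<lambda>s. P (s, \<pi>' s)) (\<lambda>s. r (s, \<pi>' s)) n x / real n) \<longlonglongrightarrow> gain P r \<pi> x"
    using gain_tendsto[of P \<pi> r x] by simp
qed

text \<open>A state that is recurrent under some policy lies in the class \<open>C\<close> of
  \<open>weakly_communicating\<close>. Both \<open>U\<close> and the set reachable from
  \<open>x\<close> contain such a state, and the two are linked inside \<open>C\<close>.\<close>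

lemma weakly_communicating_reaches_closed:
  fixes P :: "'s::finite \<times> 'a::finite \<Rightarrow> 's pmf"
  assumes "weakly_communicating P" and "closed_under (\<lambda>s. P (s, \<pi> s)) U" and "U \<noteq> {}"
  shows "\<exists>y\<in>U. (x, y) \<in> (step_rel P)\<^sup>*"
proof -
  obtain C where C: "\<forall>s\<in>C. \<forall>s'\<in>C. s \<noteq> s' \<longrightarrow> (\<exists>\<pi>. accessible_under P \<pi> s s')"
    and trans: "\<forall>s. s \<notin> C \<longrightarrow> (\<forall>\<pi>. transient_under P \<pi> s)"
    using assms(1) unfolding weakly_communicating_def by (elim exE conjE)
  obtain y where y: "y \<in> U" "y \<in> C"
    by (rule closed_under_obtains_recurrent[where P = P and \<pi> = \<pi>, OF assms(2,3)])
      (use trans in blast)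
  let ?V = "(step_rel P)\<^sup>* `` {x}"
  have "closed_under (\<lambda>s. P (s, \<pi> s)) ?V"
    unfolding closed_under_def
  proof (intro ballI subsetI)
    fix z w assume "z \<in> ?V" "w \<in> set_pmf (P (z, \<pi> z))"
    moreover from this have "(z, w) \<in> step_rel P"
      by (auto simp: step_rel_def)
    ultimately show "w \<in> ?V"
      by (auto intro: rtrancl_into_rtrancl[of x z])
  qed
  moreover have "?V \<noteq> {}"
    by auto
  ultimately obtain z where z: "(x, z) \<in> (step_rel P)\<^sup>*" "z \<in> C"
    by (rule closed_under_obtains_recurrent[where P = P and \<pi> = \<pi>]) (use trans in blast)
  have "(z, y) \<in> (step_rel P)\<^sup>*"
    using C z(2) y(2) accessible_under_imp_reachable by (cases "z = y") fastforce+
  thus ?thesis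
    using y(1) rtrancl_trans[OF z(1)] by blast
qed

text \<open>
  The new policy follows \<open>\<pi>\<close> inside \<open>U\<close> and outside decreases the distance to \<open>U\<close> with positive
  probability.
\<close>

lemma attracting_policy:
  fixes P :: "'s::finite \<times> 'a::finite \<Rightarrow> 's pmf"
  assumes "\<And>x. \<exists>y\<in>U. (x, y) \<in> (step_rel P)\<^sup>*"
  obtains \<pi>' where "\<And>x. x \<in> U \<Longrightarrow> \<pi>' x = \<pi> x"
    and "\<And>V. closed_under (\<lambda>s. P (s, \<pi>' s)) V \<Longrightarrow> V \<noteq> {} \<Longrightarrow> V \<inter> U \<noteq> {}"
proof -
  define d where "d x = (LEAST n. \<exists>y\<in>U. (x, y) \<in> step_rel P ^^ n)" for x
  have d: "\<exists>y\<in>U. (x, y) \<in> step_rel P ^^ d x" for x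
  proof -
    obtain n where "\<exists>y\<in>U. (x, y) \<in> step_rel P ^^ n"
      using assms[of x] by (meson rtrancl_imp_relpow)
    thus ?thesis
      unfolding d_def by (rule LeastI)
  qed
  have decr: "\<exists>a y. y \<in> set_pmf (P (x, a)) \<and> d y < d x" if "x \<notin> U" for x
  proof -
    obtain z where z: "z \<in> U" "(x, z) \<in> step_rel P ^^ d x"
      using d by blast
    have "d x \<noteq> 0"
      using z \<open>x \<notin> U\<close> by (intro notI) auto
    then obtain k where k: "d x = Suc k"
      using not0_implies_Suc by blast
    obtain y where y: "(x, y) \<in> step_rel P" "(y, z) \<in> step_rel P ^^ k"
      using z(2) unfolding k by (meson relpow_Suc_D2)
    have "d y \<le> k"
      unfolding d_def using y(2) z(1) by (intro Least_le) blast
    moreover obtain a where "y \<in> set_pmf (P (x, a))"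
      using y(1) by (auto simp: step_rel_def)
    ultimately show ?thesis
      using k by (metis le_imp_less_Suc)
  qed
  then obtain \<sigma> where \<sigma>: "\<And>x. x \<notin> U \<Longrightarrow> \<exists>y. y \<in> set_pmf (P (x, \<sigma> x)) \<and> d y < d x"
    by metis
  define \<pi>' where "\<pi>' x = (if x \<in> U then \<pi> x else \<sigma> x)" for x
  have "V \<inter> U \<noteq> {}" if V: "closed_under (\<lambda>s. P (s, \<pi>' s)) V" "V \<noteq> {}" for V
  proof
    assume disj: "V \<inter> U = {}"
    \<comment> \<open>A state of \<open>V\<close> nearest to \<open>U\<close>: being outside
      \<open>U\<close>, it has a successor under the new policy that is strictly nearer and still in
      \<open>V\<close>.\<close>
    obtain x where x: "x \<in> V" "\<And>y. y \<in> V \<Longrightarrow> d x \<le> d y"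
      using ex_has_least_nat[of "\<lambda>x. x \<in> V" _ d] V(2) by blast
    hence "x \<notin> U"
      using disj by blast
    then obtain y where y: "y \<in> set_pmf (P (x, \<pi>' x))" "d y < d x"
      using \<sigma> by (auto simp: \<pi>'_def)
    hence "y \<in> V"
      using V(1) x(1) by (auto simp: closed_under_def)
    thus False
      using x(2)[of y] y(2) by simp
  qed
  thus thesis
    by (intro that[of \<pi>']) (auto simp: \<pi>'_def)
qed

section \<open>Constancy of the optimal gain and the final bound\<close>

lemma optimal_gain_at_ge:
  fixes P :: "'s::finite \<times> 'a::finite \<Rightarrow> 's pmf"
  shows "gain P r \<pi> s \<le> optimal_gain_at P r s"
  unfolding optimal_gain_at_def by (rule Max_ge) auto

lemma optimal_gain_at_attained:
  fixes P :: "'s::finite \<times> 'a::finite \<Rightarrow> 's pmf"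
  obtains \<pi> where "optimal_gain_at P r s = gain P r \<pi> s"
proof -
  have "optimal_gain_at P r s \<in> range (\<lambda>\<pi>. gain P r \<pi> s)"
    unfolding optimal_gain_at_def by (rule Max_in) auto
  thus thesis using that by blast
qed

lemma optimal_gain_at_const:
  fixes P :: "'s::finite \<times> 'a::finite \<Rightarrow> 's pmf"
  assumes "weakly_communicating P"
  shows "optimal_gain_at P r s = (MAX x. optimal_gain_at P r x)"
proof (rule antisym)
  define G where "G = (MAX x. optimal_gain_at P r x)"
  have le_G: "optimal_gain_at P r x \<le> G" for x
    unfolding G_def by (rule Max_ge) auto
  thus "optimal_gain_at P r s \<le> (MAX x. optimal_gain_at P r x)"
    by (simp add: G_def)
  have gain_le_G: "gain P r \<pi> x \<le> G" for \<pi> x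
    using optimal_gain_at_ge le_G by (rule order_trans)
  have "G \<in> range (optimal_gain_at P r)"
    unfolding G_def by (rule Max_in) auto
  then obtain \<pi> s\<^sub>1 where s1: "gain P r \<pi> s\<^sub>1 = G"
    using optimal_gain_at_attained by (metis imageE)
  define U where "U = {x. gain P r \<pi> x = G}"
  have "(MAX x. gain P r \<pi> x) = G"
    using s1 gain_le_G by (intro Max_eqI) auto
  hence U: "closed_under (\<lambda>s. P (s, \<pi> s)) U"
    using closed_under_max_harmonic[of _ "gain P r \<pi>", OF push_gain] by (simp add: U_def)
  have "U \<noteq> {}"
    using s1 by (auto simp: U_def)
  hence "\<exists>y\<in>U. (x, y) \<in> (step_rel P)\<^sup>*" for x
    by (rule weakly_communicating_reaches_closed[where \<pi> = \<pi>, OF assms U])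
  then obtain \<pi>' where \<pi>': "\<And>x. x \<in> U \<Longrightarrow> \<pi>' x = \<pi> x"
    and hits: "\<And>V. closed_under (\<lambda>s. P (s, \<pi>' s)) V \<Longrightarrow> V \<noteq> {} \<Longrightarrow> V \<inter> U \<noteq> {}"
    by (rule attracting_policy[of U P \<pi>]) blast+
  \<comment> \<open>The sign turns the minimum of the gain of \<open>\<pi>'\<close> into a maximum,
    so the set of minimizers is closed and meets \<open>U\<close>. There the gain is
    \<open>G\<close>, hence it is at least \<open>G\<close> everywhere.\<close>
  define f where "f x = - gain P r \<pi>' x" for x
  have harm: "push (\<lambda>s. P (s, \<pi>' s)) f x = f x" for x
    unfolding f_def[abs_def] by (simp add: push_uminus push_gain)
  have "(MAX x. f x) \<in> range f"
    by (rule Max_in) auto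
  hence "{x. f x = (MAX x. f x)} \<noteq> {}" by (metis (mono_tags) Collect_empty_eq imageE)
  then obtain x where x: "x \<in> U" "f x = (MAX x. f x)"
    using hits[OF closed_under_max_harmonic[OF harm]] by blast
  have "f s \<le> (MAX x. f x)"
    by (rule Max_ge) auto
  also have "\<dots> = - gain P r \<pi> x"
    using x gain_eq_on_closed[of P \<pi> U \<pi>', OF U \<pi>'] by (simp add: f_def)
  also have "\<dots> = - G"
    using x by (simp add: U_def)
  finally show "(MAX x. optimal_gain_at P r x) \<le> optimal_gain_at P r s"
    using optimal_gain_at_ge[of P r \<pi>' s] unfolding f_def G_def by linarith
qed

text \<open>Constancy is what makes the \<open>THE\<close> in \<open>optimal_gain\<close> well
  defined.\<close>

lemma optimal_gain_at_eq_optimal_gain: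
  fixes P :: "'s::finite \<times> 'a::finite \<Rightarrow> 's pmf"
  assumes "weakly_communicating P"
  shows "optimal_gain_at P r s = optimal_gain P r"
  unfolding optimal_gain_def
proof (rule the_equality[symmetric])
  show "\<forall>x. optimal_gain_at P r x = optimal_gain_at P r s"
    using optimal_gain_at_const[OF assms] by metis
qed auto

theorem proposition2p1:
  fixes P :: "'s::finite \<times> 'a::finite \<Rightarrow> 's pmf"
    and r :: "'s \<times> 'a \<Rightarrow> real"
    and Q :: "'s \<times> 'a \<Rightarrow> real"
    and \<pi> :: "'s \<Rightarrow> 'a"
  assumes "weakly_communicating P"
    and "greedy_policy Q \<pi>"
  shows "\<forall>s. 0 \<le> optimal_gain P r - gain P r \<pi> s \<and>
             optimal_gain P r - gain P r \<pi> s \<le> span_seminorm (\<lambda>z. Q z - bellman P r Q z)"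
proof
  fix s
  \<comment> \<open>The upper bound on gains is used for a policy optimal at \<open>s\<close>, the
    lower bound for the greedy one; the two bounds differ by the span of the residual.\<close>
  obtain \<pi>' where \<pi>': "optimal_gain_at P r s = gain P r \<pi>' s"
    by (rule optimal_gain_at_attained)
  show "0 \<le> optimal_gain P r - gain P r \<pi> s \<and>
    optimal_gain P r - gain P r \<pi> s \<le> span_seminorm (\<lambda>z. Q z - bellman P r Q z)"
    using optimal_gain_at_ge[of P r \<pi> s] gain_bellman_residual_bounds(1)[of P r \<pi>' s Q]
      gain_bellman_residual_bounds(2)[OF assms(2), of P r s]
    unfolding \<pi>' optimal_gain_at_eq_optimal_gain[OF assms(1), symmetric, of r s] span_seminorm_def
    by linarith
qed

end
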